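(* Let $\Theta$ be a smooth finite-dimensional Riemannian manifold, let $\theta\in\Theta$, and let $J:\Theta\to\mathbb{R}$ be differentiable at $\theta$, with Riemannian gradient $g:=\nabla J(\theta)\in T_\theta\Theta$. Let $\mathcal{V}_\theta\subset T_\theta\Theta$ be a closed linear subspace, and let $H_C(\theta):T_\theta\Theta\to T_\theta\Theta$ be a self-adjoint, positive semidefinite linear operator with $\operatorname{Im}(H_C(\theta))=\mathcal{V}_\theta$ and $\ker(H_C(\theta))=\mathcal{V}_\theta^\perp$. Let $H_C^\dagger(\theta)$ be its Moore--Penrose pseudoinverse. Put $\mathcal{E}_\theta(\Delta\theta):=\langle \Delta\theta, H_C(\theta)\Delta\theta\rangle_\theta$ and $\mathcal{D}_\theta:=\{\Delta\theta\in\mathcal{V}_\theta : \mathcal{E}_\theta(\Delta\theta)=1\}$, and consider the problem $$\max_{\Delta\theta\in\mathcal{D}_\theta}\ \langle g,\Delta\theta\rangle_\theta .\qquad ( * )$$ (1) If $H_C(\theta)g\neq 0$, then the maximizers of $( * )$ are exactly the vectors on the ray generated by $H_C^\dagger(\theta)g$, i.e. $\Delta\theta^\star\propto H_C^\dagger(\theta)g$ (with positive proportionality constant), normalized so that $\mathcal{E}_\theta(\Delta\theta^\star)=1$. (2) If $H_C(\theta)g=0$, then $\langle g,\Delta\theta\rangle_\theta=0$ for all $\Delta\theta\in\mathcal{D}_\theta$; in particular no $\Delta\theta\in\mathcal{D}_\theta$ satisfies $\langle g,\Delta\theta\rangle_\theta>0$.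
   Context: $\langle\cdot,\cdot\rangle_\theta$ denotes the inner product on the tangent space $T_\theta\Theta$ given by the Riemannian metric; gradients, adjoints, orthogonal complements and the Moore--Penrose pseudoinverse are taken with respect to it. $\mathcal{V}_\theta$ is called the computationally reachable subspace at $\theta$, $\mathcal{E}_\theta$ the computational effort functional, and the elements of $\mathcal{D}_\theta$ are the admissible strategy tangent directions. The quantity $\langle g,\Delta\theta\rangle_\theta$ is the first-order payoff variation of $J$ in the direction $\Delta\theta$. *)

theory Defs
  imports "HOL-Analysis.Analysis" "HOL-Library.Function_Algebras"
begin

section \<open>Functions into a real vector space form a real vector space\<close>

instantiation "fun" :: (type, real_vector) real_vector
begin

definition "scaleR r f = (\<lambda>x. r *\<^sub>R f x)"

instance
  by standard (auto simp: scaleR_fun_def plus_fun_def scaleR_add_right scaleR_add_left)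

end

section \<open>Smooth maps\<close>

text \<open>Only meant for open \<open>S\<close>.\<close>

primrec Ck_on :: "nat \<Rightarrow> 'a::real_normed_vector set \<Rightarrow> ('a \<Rightarrow> 'b::real_normed_vector) \<Rightarrow> bool" where
  "Ck_on 0 S f \<longleftrightarrow> continuous_on S f"
| "Ck_on (Suc k) S f \<longleftrightarrow>
     (\<forall>x\<in>S. f differentiable (at x)) \<and> (\<forall>h. Ck_on k S (\<lambda>x. frechet_derivative f (at x) h))"

definition smooth_on :: "'a::real_normed_vector set \<Rightarrow> ('a \<Rightarrow> 'b::real_normed_vector) \<Rightarrow> bool" where
  "smooth_on S f \<longleftrightarrow> (\<forall>k. Ck_on k S f)"

section \<open>Charts and tangent vectors\<close>

text \<open>A chart is a pair of an open set and a coordinate map, whose values outside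
  that set are irrelevant.\<close>

type_synonym ('m, 'e) chart = "'m set \<times> ('m \<Rightarrow> 'e)"

definition chart_inv :: "('m, 'e) chart \<Rightarrow> 'e \<Rightarrow> 'm" where
  "chart_inv c = inv_into (fst c) (snd c)"

definition is_chart :: "('m::topological_space, 'e::real_normed_vector) chart \<Rightarrow> bool" where
  "is_chart c \<longleftrightarrow> open (fst c) \<and> open (snd c ` fst c) \<and>
     homeomorphism (fst c) (snd c ` fst c) (snd c) (chart_inv c)"

definition charts_at :: "('m, 'e) chart set \<Rightarrow> 'm \<Rightarrow> ('m, 'e) chart set" where
  "charts_at A p = {c \<in> A. p \<in> fst c}"

definition points :: "('m, 'e) chart set \<Rightarrow> 'm set" where
  "points A = (\<Union>c\<in>A. fst c)"

definition transition_deriv ::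
    "('m, 'e::real_normed_vector) chart \<Rightarrow> ('m, 'e) chart \<Rightarrow> 'm \<Rightarrow> 'e \<Rightarrow> 'e" where
  "transition_deriv c d p = frechet_derivative (snd d \<circ> chart_inv c) (at (snd c p))"

text \<open>A tangent vector at \<open>p\<close> is the family of its coordinate representations in all charts
  around \<open>p\<close>, related by the derivatives of the coordinate changes, and extended by \<open>0\<close> to the
  remaining pairs so that tangent vectors are equal iff their representations agree.\<close>

type_synonym ('m, 'e) tvec = "('m, 'e) chart \<Rightarrow> 'e"

definition tangent_space ::
    "('m, 'e::real_normed_vector) chart set \<Rightarrow> 'm \<Rightarrow> ('m, 'e) tvec set" where
  "tangent_space A p = {v.
     (\<forall>c\<in>charts_at A p. \<forall>d\<in>charts_at A p. v d = transition_deriv c d p (v c)) \<and>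
     (\<forall>c. c \<notin> charts_at A p \<longrightarrow> v c = 0)}"

text \<open>The tangent vector at \<open>p\<close> represented by \<open>a\<close> in the chart \<open>c\<close>.\<close>

definition coord_vec ::
    "('m, 'e::real_normed_vector) chart set \<Rightarrow> ('m, 'e) chart \<Rightarrow> 'm \<Rightarrow> 'e \<Rightarrow> ('m, 'e) tvec" where
  "coord_vec A c p a = (\<lambda>d. if d \<in> charts_at A p then transition_deriv c d p a else 0)"

section \<open>Riemannian manifolds\<close>

text \<open>The model space is any finite-dimensional normed space rather than a type of class
  \<open>euclidean_space\<close>, since the latter would exclude dimension 0.\<close>

locale smooth_manifold =
  fixes A :: "('m::{t2_space, second_countable_topology}, 'e::real_normed_vector) chart set"
  assumes finite_dim: "\<exists>B :: 'e set. finite B \<and> span B = UNIV"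
    and charts: "c \<in> A \<Longrightarrow> is_chart c"
    and compatible: "c \<in> A \<Longrightarrow> d \<in> A \<Longrightarrow>
          smooth_on (snd c ` (fst c \<inter> fst d)) (snd d \<circ> chart_inv c)"

type_synonym ('m, 'e) metric = "'m \<Rightarrow> ('m, 'e) tvec \<Rightarrow> ('m, 'e) tvec \<Rightarrow> real"

locale riemannian_manifold = smooth_manifold A
  for A :: "('m::{t2_space, second_countable_topology}, 'e::real_normed_vector) chart set" +
  fixes G :: "('m, 'e) metric"
  assumes metric_add: "\<lbrakk>p \<in> points A; u \<in> tangent_space A p; v \<in> tangent_space A p;
            w \<in> tangent_space A p\<rbrakk> \<Longrightarrow> G p (u + v) w = G p u w + G p v w"
    and metric_scale: "\<lbrakk>p \<in> points A; u \<in> tangent_space A p; w \<in> tangent_space A p\<rbrakk> \<Longrightarrow>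
            G p (r *\<^sub>R u) w = r * G p u w"
    and metric_sym: "\<lbrakk>p \<in> points A; u \<in> tangent_space A p; v \<in> tangent_space A p\<rbrakk> \<Longrightarrow>
            G p u v = G p v u"
    and metric_pos: "\<lbrakk>p \<in> points A; u \<in> tangent_space A p; u \<noteq> 0\<rbrakk> \<Longrightarrow> 0 < G p u u"
    and metric_smooth: "c \<in> A \<Longrightarrow>
            smooth_on (snd c ` fst c) (\<lambda>x. let p = chart_inv c x in
              G p (coord_vec A c p a) (coord_vec A c p b))"

definition tangent_topology ::
    "('m, 'e::real_normed_vector) chart set \<Rightarrow> ('m, 'e) metric \<Rightarrow> 'm \<Rightarrow> ('m, 'e) tvec topology" where
  "tangent_topology A G p =
     Metric_space.mtopology (tangent_space A p) (\<lambda>u v. sqrt (G p (u - v) (u - v)))"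

definition orthogonal_compl ::
    "('m, 'e::real_normed_vector) chart set \<Rightarrow> ('m, 'e) metric \<Rightarrow> 'm \<Rightarrow> ('m, 'e) tvec set \<Rightarrow>
     ('m, 'e) tvec set" where
  "orthogonal_compl A G p V = {u \<in> tangent_space A p. \<forall>v\<in>V. G p u v = 0}"

section \<open>Differential and gradient\<close>

definition differentiable_at ::
    "('m, 'e::real_normed_vector) chart set \<Rightarrow> ('m \<Rightarrow> real) \<Rightarrow> 'm \<Rightarrow> bool" where
  "differentiable_at A J p \<longleftrightarrow>
     (\<forall>c\<in>charts_at A p. (J \<circ> chart_inv c) differentiable (at (snd c p)))"

text \<open>By the chain rule the value does not depend on the chosen chart.\<close>

definition differential ::
    "('m, 'e::real_normed_vector) chart set \<Rightarrow> ('m \<Rightarrow> real) \<Rightarrow> 'm \<Rightarrow> ('m, 'e) tvec \<Rightarrow> real" where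
  "differential A J p v =
     (let c = (SOME c. c \<in> charts_at A p)
      in frechet_derivative (J \<circ> chart_inv c) (at (snd c p)) (v c))"

definition gradient ::
    "('m, 'e::real_normed_vector) chart set \<Rightarrow> ('m, 'e) metric \<Rightarrow> ('m \<Rightarrow> real) \<Rightarrow> 'm \<Rightarrow>
     ('m, 'e) tvec" where
  "gradient A G J p = (THE g. g \<in> tangent_space A p \<and>
     (\<forall>v\<in>tangent_space A p. G p g v = differential A J p v))"

section \<open>Operators on a tangent space\<close>

definition linear_operator_on :: "'v::real_vector set \<Rightarrow> ('v \<Rightarrow> 'v) \<Rightarrow> bool" where
  "linear_operator_on T H \<longleftrightarrow> H \<in> T \<rightarrow> T \<and>
     (\<forall>u\<in>T. \<forall>v\<in>T. H (u + v) = H u + H v) \<and> (\<forall>r. \<forall>u\<in>T. H (r *\<^sub>R u) = r *\<^sub>R H u)"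

definition self_adjoint ::
    "('m, 'e::real_normed_vector) chart set \<Rightarrow> ('m, 'e) metric \<Rightarrow> 'm \<Rightarrow>
     (('m, 'e) tvec \<Rightarrow> ('m, 'e) tvec) \<Rightarrow> bool" where
  "self_adjoint A G p H \<longleftrightarrow>
     (\<forall>u\<in>tangent_space A p. \<forall>v\<in>tangent_space A p. G p (H u) v = G p u (H v))"

definition pos_semidef ::
    "('m, 'e::real_normed_vector) chart set \<Rightarrow> ('m, 'e) metric \<Rightarrow> 'm \<Rightarrow>
     (('m, 'e) tvec \<Rightarrow> ('m, 'e) tvec) \<Rightarrow> bool" where
  "pos_semidef A G p H \<longleftrightarrow> (\<forall>u\<in>tangent_space A p. 0 \<le> G p u (H u))"

text \<open>The four Penrose equations. Extensionality makes the operator on the tangent space a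
  unique HOL function.\<close>

definition pseudoinverse ::
    "('m, 'e::real_normed_vector) chart set \<Rightarrow> ('m, 'e) metric \<Rightarrow> 'm \<Rightarrow>
     (('m, 'e) tvec \<Rightarrow> ('m, 'e) tvec) \<Rightarrow> ('m, 'e) tvec \<Rightarrow> ('m, 'e) tvec" where
  "pseudoinverse A G p H = (THE P. P \<in> extensional (tangent_space A p) \<and>
     linear_operator_on (tangent_space A p) P \<and>
     (\<forall>u\<in>tangent_space A p. H (P (H u)) = H u) \<and>
     (\<forall>u\<in>tangent_space A p. P (H (P u)) = P u) \<and>
     self_adjoint A G p (H \<circ> P) \<and> self_adjoint A G p (P \<circ> H))"

section \<open>Effort and admissible directions\<close>

definition effort ::
    "('m, 'e) metric \<Rightarrow> 'm \<Rightarrow> (('m, 'e) tvec \<Rightarrow> ('m, 'e) tvec) \<Rightarrow> ('m, 'e) tvec \<Rightarrow> real" where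
  "effort G p H u = G p u (H u)"

definition admissible ::
    "('m, 'e) metric \<Rightarrow> 'm \<Rightarrow> (('m, 'e) tvec \<Rightarrow> ('m, 'e) tvec) \<Rightarrow> ('m, 'e) tvec set \<Rightarrow>
     ('m, 'e) tvec set" where
  "admissible G p H V = {u \<in> V. effort G p H u = 1}"

end

theory Submission
  imports Defs
begin

text \<open>
  The problem is linear algebra on one finite-dimensional tangent space \<open>T\<close>: by the
  conditions on range and kernel, \<open>H\<close> maps \<open>V\<close> bijectively to itself and annihilates the orthogonal
  complement of \<open>V\<close>. So the vector \<open>z = H\<^sup>\<dagger> g\<close> is the element of \<open>V\<close> whose image \<open>H z\<close> is the orthogonal
  projection of \<open>g\<close> onto \<open>V\<close>, and for \<open>u \<in> V\<close> the payoff is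
  \<open>\<langle>g, u\<rangle> = \<langle>H z, u\<rangle> = \<langle>z, H u\<rangle>\<close>. The quadratic form of a positive semidefinite
  operator vanishes only on its kernel, so \<open>\<langle>u, H v\<rangle>\<close> is an inner product on \<open>V\<close>, with the admissible directions as its unit sphere.
  The payoff is the product with \<open>z\<close> for this inner product, and by Cauchy--Schwarz with its
  equality case it is maximal on the sphere exactly at the normalization of \<open>z\<close>, provided \<open>z \<noteq> 0\<close>
  (\<open>maximizer_iff\<close>). The case \<open>H g = 0\<close> says that \<open>g\<close> is orthogonal to \<open>V\<close>.

  The rest is existence. Finite dimension of \<open>T\<close> (\<open>finite_dim_tangent_space\<close>) gives Riesz
  representation and orthogonal projections. These provide the gradient as an actual tangent vector
  and a candidate for \<open>H\<^sup>\<dagger>\<close>, which satisfies the Penrose equations (\<open>penrose_pinv\<close>) and hence is the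
  pseudoinverse (\<open>penrose_unique\<close>).
\<close>

section \<open>Inner products on a subspace\<close>

locale inner_product_on =
  fixes T :: "'v::real_vector set" and ip :: "'v \<Rightarrow> 'v \<Rightarrow> real"
  assumes subspace_carrier: "subspace T"
    and add_left: "\<lbrakk>u \<in> T; v \<in> T; w \<in> T\<rbrakk> \<Longrightarrow> ip (u + v) w = ip u w + ip v w"
    and scale_left: "\<lbrakk>u \<in> T; w \<in> T\<rbrakk> \<Longrightarrow> ip (r *\<^sub>R u) w = r * ip u w"
    and sym: "\<lbrakk>u \<in> T; v \<in> T\<rbrakk> \<Longrightarrow> ip u v = ip v u"
    and pos: "\<lbrakk>u \<in> T; u \<noteq> 0\<rbrakk> \<Longrightarrow> 0 < ip u u"
begin

lemma carrier_closed [simp]: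
  shows "0 \<in> T" "\<lbrakk>u \<in> T; v \<in> T\<rbrakk> \<Longrightarrow> u + v \<in> T" "u \<in> T \<Longrightarrow> r *\<^sub>R u \<in> T"
    "\<lbrakk>u \<in> T; v \<in> T\<rbrakk> \<Longrightarrow> u - v \<in> T"
  using subspace_carrier by (auto simp: subspace_0 subspace_add subspace_scale subspace_diff)

lemma add_right: "\<lbrakk>u \<in> T; v \<in> T; w \<in> T\<rbrakk> \<Longrightarrow> ip w (u + v) = ip w u + ip w v"
  using add_left[of u v w] sym[of w] by simp

lemma scale_right: "\<lbrakk>u \<in> T; w \<in> T\<rbrakk> \<Longrightarrow> ip w (r *\<^sub>R u) = r * ip w u"
  using scale_left[of u w r] sym[of w] by simp

lemma diff_left: "\<lbrakk>u \<in> T; v \<in> T; w \<in> T\<rbrakk> \<Longrightarrow> ip (u - v) w = ip u w - ip v w"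
  using add_left[of u "(-1) *\<^sub>R v" w] scale_left[of v w "-1"] carrier_closed(3)[of v "-1"] by simp

lemma diff_right: "\<lbrakk>u \<in> T; v \<in> T; w \<in> T\<rbrakk> \<Longrightarrow> ip w (u - v) = ip w u - ip w v"
  using diff_left[of u v w] sym[of w] by simp

lemma zero_left [simp]: "w \<in> T \<Longrightarrow> ip 0 w = 0"
  using scale_left[of 0 w 0] by simp

lemma eq_0_if_norm_0: "\<lbrakk>u \<in> T; ip u u = 0\<rbrakk> \<Longrightarrow> u = 0"
  using pos[of u] by auto

lemma eq_if_ip_eq:
  assumes "u \<in> T" "v \<in> T" "\<And>w. w \<in> T \<Longrightarrow> ip u w = ip v w"
  shows "u = v"
  using eq_0_if_norm_0[of "u - v"] assms diff_left[of u v "u - v"] by simp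

text \<open>The Riesz representation theorem, by an induction that is Gram--Schmidt orthogonalization in
  disguise: the hypothesis for \<open>B\<close>, applied to the functional \<open>ip b\<close>, yields the orthogonal
  projection of a further generator \<open>b\<close>, and the component of \<open>b\<close> orthogonal to \<open>span B\<close> carries
  the new part of the representing vector.\<close>

lemma Riesz_representation_span:
  assumes "finite B" "B \<subseteq> T"
    and "\<And>u v. \<lbrakk>u \<in> span B; v \<in> span B\<rbrakk> \<Longrightarrow> f (u + v) = f u + f v"
    and "\<And>r u. u \<in> span B \<Longrightarrow> f (r *\<^sub>R u) = r * f u"
  shows "\<exists>g\<in>span B. \<forall>v\<in>span B. ip g v = f v"
  using assms
proof (induction B arbitrary: f rule: finite_induct)
  case empty
  from empty.prems(3)[of 0 0] show ?case by simp
next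
  case (insert b B)
  have sub: "span B \<subseteq> T" and b: "b \<in> T"
    using insert.prems(1) subspace_carrier span_minimal[of B T] by auto
  have mono: "x \<in> span (insert b B)" if "x \<in> span B" for x
    using that span_mono[of B "insert b B"] by auto
  have "\<exists>p\<in>span B. \<forall>v\<in>span B. ip p v = ip b v"
    using insert.prems(1) sub b by (intro insert.IH) (auto simp: add_right scale_right subsetD)
  then obtain p where p: "p \<in> span B" and p_ip: "\<And>v. v \<in> span B \<Longrightarrow> ip p v = ip b v" by blast
  have "\<exists>g\<in>span B. \<forall>v\<in>span B. ip g v = f v"
    using insert.prems mono by (intro insert.IH) auto
  then obtain g where g: "g \<in> span B" and g_ip: "\<And>v. v \<in> span B \<Longrightarrow> ip g v = f v" by blast
  define e where "e = b - p"
  have e_orth: "ip e v = 0" if "v \<in> span B" for v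
    using that p p_ip[of v] sub b by (auto simp: e_def diff_left subsetD)
  have eT: "e \<in> T" using p sub b by (auto simp: e_def)
  have e_span: "e \<in> span (insert b B)"
    unfolding e_def using p mono by (auto intro: span_diff span_base)
  have decomp: "\<exists>w k. w \<in> span B \<and> v = w + k *\<^sub>R e" if v: "v \<in> span (insert b B)" for v
  proof -
    obtain k where k: "v - k *\<^sub>R b \<in> span B" using v span_breakdown_eq by blast
    have "v = ((v - k *\<^sub>R b) + k *\<^sub>R p) + k *\<^sub>R e" by (simp add: e_def algebra_simps)
    then show ?thesis using span_add[OF k span_scale[OF p]] by blast
  qed
  \<comment> \<open>If \<open>e = 0\<close> then this is \<open>g\<close>, because of \<open>x / 0 = 0\<close>.\<close>
  define g' where "g' = g + (f e / ip e e) *\<^sub>R e"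
  have fe: "f e / ip e e * ip e e = f e"
    using pos[OF eT] insert.prems(3)[of 0 0] span_zero by (cases "e = 0") auto
  show ?case
  proof (intro bexI ballI)
    show "g' \<in> span (insert b B)"
      unfolding g'_def using g mono e_span by (auto intro: span_add span_scale)
  next
    fix v assume "v \<in> span (insert b B)"
    then obtain w k where w: "w \<in> span B" and v: "v = w + k *\<^sub>R e" using decomp by blast
    have T: "w \<in> T" "g \<in> T" using w g sub by auto
    have "ip g' v = ip g w + k * ip g e + f e / ip e e * (ip e w + k * ip e e)"
      unfolding g'_def v using T eT
      by (simp add: add_left add_right scale_left scale_right algebra_simps)
    also have "\<dots> = f w + k * (f e / ip e e * ip e e)"
      using g_ip[OF w] e_orth[OF w] e_orth[OF g] sym[of g e] T eT by simp
    also have "\<dots> = f v"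
      unfolding v fe using insert.prems(2,3) mono w e_span by (auto simp: span_scale)
    finally show "ip g' v = f v" .
  qed
qed

lemma orthogonal_projection_span:
  assumes "finite B" "B \<subseteq> T" "u \<in> T"
  shows "\<exists>w\<in>span B. \<forall>v\<in>span B. ip (u - w) v = 0"
proof -
  have sub: "span B \<subseteq> T" using assms(2) subspace_carrier span_minimal by blast
  have "\<exists>w\<in>span B. \<forall>v\<in>span B. ip w v = ip u v"
    using assms sub by (intro Riesz_representation_span) (auto simp: add_right scale_right subsetD)
  then obtain w where w: "w \<in> span B" "\<And>v. v \<in> span B \<Longrightarrow> ip w v = ip u v" by blast
  then have "ip (u - w) v = 0" if "v \<in> span B" for v
    using that sub assms(3) by (simp add: diff_left subsetD)
  then show ?thesis using w(1) by blast
qed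

section \<open>The Moore--Penrose pseudoinverse\<close>

definition self_adjoint_on :: "('v \<Rightarrow> 'v) \<Rightarrow> bool" where
  "self_adjoint_on H \<longleftrightarrow> (\<forall>u\<in>T. \<forall>v\<in>T. ip (H u) v = ip u (H v))"

definition penrose :: "('v \<Rightarrow> 'v) \<Rightarrow> ('v \<Rightarrow> 'v) \<Rightarrow> bool" where
  "penrose H P \<longleftrightarrow> P \<in> extensional T \<and> linear_operator_on T P \<and>
     (\<forall>u\<in>T. H (P (H u)) = H u) \<and> (\<forall>u\<in>T. P (H (P u)) = P u) \<and>
     self_adjoint_on (H \<circ> P) \<and> self_adjoint_on (P \<circ> H)"

text \<open>The adjoint of \<open>F \<circ> E\<close> is \<open>E \<circ> F\<close>. So if \<open>F \<circ> E = E\<close>, taking adjoints gives \<open>E \<circ> F = E\<close>, and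
  \<open>E \<circ> F = F\<close> then identifies \<open>E\<close> with \<open>F\<close>. For two pseudoinverses \<open>P\<close> and \<open>Q\<close> of \<open>H\<close>, the
  first alternative covers \<open>H \<circ> P\<close> and \<open>H \<circ> Q\<close>, the second one \<open>P \<circ> H\<close> and \<open>Q \<circ> H\<close>.\<close>

lemma self_adjoint_on_eqI:
  assumes "self_adjoint_on E" "self_adjoint_on F"
    and EF: "E \<in> T \<rightarrow> T" "F \<in> T \<rightarrow> T"
    and absorb: "(\<forall>u\<in>T. F (E u) = E u \<and> E (F u) = F u) \<or> (\<forall>u\<in>T. E (F u) = E u \<and> F (E u) = F u)"
    and "u \<in> T"
  shows "E u = F u"
proof (rule eq_if_ip_eq)
  show "E u \<in> T" "F u \<in> T" using EF \<open>u \<in> T\<close> by auto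
  fix w assume w: "w \<in> T"
  have mem: "E x \<in> T" "F x \<in> T" if "x \<in> T" for x using that EF by auto
  have E: "ip (E x) y = ip x (E y)" and F: "ip (F x) y = ip x (F y)" if "x \<in> T" "y \<in> T" for x y
    using that assms(1,2) by (auto simp: self_adjoint_on_def)
  have *: "ip (F (E u)) w = ip u (E (F w))" "ip (E (F u)) w = ip u (F (E w))"
    using mem \<open>u \<in> T\<close> w by (simp_all add: E F)
  from absorb show "ip (E u) w = ip (F u) w"
    using * E[of u w] F[of u w] w \<open>u \<in> T\<close> by auto
qed

text \<open>Both \<open>H \<circ> P\<close> and \<open>P \<circ> H\<close> are determined by \<open>H\<close>, by the previous lemma; so is
  \<open>P = P \<circ> H \<circ> P\<close>, where either factor \<open>P\<close> may then be exchanged for \<open>Q\<close>.\<close>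

lemma penrose_unique:
  assumes H: "linear_operator_on T H" and P: "penrose H P" and Q: "penrose H Q"
  shows "P = Q"
proof (rule extensionalityI)
  show "P \<in> extensional T" "Q \<in> extensional T" using P Q by (auto simp: penrose_def)
  fix u assume u: "u \<in> T"
  have mem: "H x \<in> T" "P x \<in> T" "Q x \<in> T" if "x \<in> T" for x
    using that H P Q by (auto simp: penrose_def linear_operator_on_def)
  have eqs: "H (P (H x)) = H x" "P (H (P x)) = P x" "H (Q (H x)) = H x" "Q (H (Q x)) = Q x"
    if "x \<in> T" for x using that P Q by (auto simp: penrose_def)
  have HP: "H (P x) = H (Q x)" if x: "x \<in> T" for x
  proof -
    have "(H \<circ> P) x = (H \<circ> Q) x"
      using P Q
      by (intro self_adjoint_on_eqI[of "H \<circ> P" "H \<circ> Q", OF _ _ _ _ _ x])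
        (auto simp: penrose_def mem eqs)
    then show ?thesis by simp
  qed
  have PH: "P (H x) = Q (H x)" if x: "x \<in> T" for x
  proof -
    have "(P \<circ> H) x = (Q \<circ> H) x"
      using P Q
      by (intro self_adjoint_on_eqI[of "P \<circ> H" "Q \<circ> H", OF _ _ _ _ _ x])
        (auto simp: penrose_def mem eqs)
    then show ?thesis by simp
  qed
  have "P u = P (H (P u))" using eqs u by simp
  also have "\<dots> = P (H (Q u))" using HP u by simp
  also have "\<dots> = Q (H (Q u))" using PH mem u by simp
  also have "\<dots> = Q u" using eqs u by simp
  finally show "P u = Q u" .
qed

end

section \<open>Linear maximization over the effort sphere\<close>

locale effort_operator = inner_product_on T ip for T :: "'v::real_vector set" and ip +
  fixes H :: "'v \<Rightarrow> 'v" and V :: "'v set"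
  assumes finite_dim: "\<exists>B. finite B \<and> T = span B"
    and V_sub: "V \<subseteq> T" and V_subspace: "subspace V"
    and H_linear: "linear_operator_on T H"
    and H_self_adjoint: "self_adjoint_on H"
    and H_psd: "u \<in> T \<Longrightarrow> 0 \<le> ip u (H u)"
    and H_range: "H ` T = V"
    and H_kernel: "{u \<in> T. H u = 0} = {u \<in> T. \<forall>v\<in>V. ip u v = 0}"
begin

lemma V_T [simp]: "u \<in> V \<Longrightarrow> u \<in> T"
  using V_sub by auto

lemma H_closed [simp]: "u \<in> T \<Longrightarrow> H u \<in> T" "u \<in> T \<Longrightarrow> H u \<in> V"
  using H_range V_sub by auto

lemma V_closed:
  "\<lbrakk>u \<in> V; v \<in> V\<rbrakk> \<Longrightarrow> u + v \<in> V" "u \<in> V \<Longrightarrow> r *\<^sub>R u \<in> V" "\<lbrakk>u \<in> V; v \<in> V\<rbrakk> \<Longrightarrow> u - v \<in> V"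
  using V_subspace by (auto simp: subspace_add subspace_scale subspace_diff)

lemma H_add: "\<lbrakk>u \<in> T; v \<in> T\<rbrakk> \<Longrightarrow> H (u + v) = H u + H v"
  and H_scale: "u \<in> T \<Longrightarrow> H (r *\<^sub>R u) = r *\<^sub>R H u"
  using H_linear by (auto simp: linear_operator_on_def)

lemma H_diff: "\<lbrakk>u \<in> T; v \<in> T\<rbrakk> \<Longrightarrow> H (u - v) = H u - H v"
  using H_add[of u "(-1) *\<^sub>R v"] H_scale[of v "-1"] carrier_closed(3)[of v "-1"] by simp

lemma H_swap: "\<lbrakk>u \<in> T; v \<in> T\<rbrakk> \<Longrightarrow> ip (H u) v = ip u (H v)"
  using H_self_adjoint by (auto simp: self_adjoint_on_def)

lemma H_0_iff: "u \<in> T \<Longrightarrow> H u = 0 \<longleftrightarrow> (\<forall>v\<in>V. ip u v = 0)"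
  using H_kernel by blast

lemma H_inj_on_V: "\<lbrakk>u \<in> V; v \<in> V; H u = H v\<rbrakk> \<Longrightarrow> u = v"
  using H_0_iff[of "u - v"] eq_0_if_norm_0[of "u - v"] V_closed(3)[of u v] by (simp add: H_diff)

lemma V_span: "\<exists>B. finite B \<and> B \<subseteq> T \<and> V = span B"
proof -
  obtain B where B: "finite B" "T = span B" using finite_dim by blast
  obtain C where C: "C \<subseteq> V" "independent C" "V \<subseteq> span C"
    using maximal_independent_subset by blast
  have "finite C" using independent_span_bound[OF B(1) C(2)] C(1) V_sub B(2) by auto
  moreover have "span C = V" using C V_subspace span_minimal by blast
  ultimately show ?thesis using C(1) V_sub by blast
qed

text \<open>The orthogonal projection \<open>H t\<close> of \<open>u\<close> onto \<open>V\<close> has a preimage in \<open>V\<close> itself, namely the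
  projection of \<open>t\<close>, since \<open>H\<close> annihilates the orthogonal complement of \<open>V\<close>. Uniqueness
  is that \<open>H\<close> is injective on \<open>V\<close>.\<close>

lemma ex1_projection_preimage:
  assumes u: "u \<in> T"
  shows "\<exists>!z. z \<in> V \<and> H (u - H z) = 0"
proof -
  have proj: "\<exists>w\<in>V. H (u - w) = 0" if u: "u \<in> T" for u
  proof -
    obtain B where "finite B" "B \<subseteq> T" "V = span B" using V_span by blast
    then obtain w where "w \<in> V" "\<forall>v\<in>V. ip (u - w) v = 0"
      using orthogonal_projection_span[OF _ _ u, of B] by blast
    then show ?thesis using H_0_iff[of "u - w"] u by auto
  qed
  obtain w where w: "w \<in> V" "H (u - w) = 0" using proj[OF u] by blast
  obtain t where t: "t \<in> T" "w = H t" using w(1) H_range by blast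
  obtain z where z: "z \<in> V" "H (t - z) = 0" using proj[OF t(1)] by blast
  have "w = H z" using t z by (simp add: H_diff)
  moreover have "z' = z" if "z' \<in> V" "H (u - H z') = 0" for z'
  proof -
    have "H (H z') = H (H z)" using that w \<open>w = H z\<close> u z by (simp add: H_diff)
    then show ?thesis using H_inj_on_V that(1) z(1) by simp
  qed
  ultimately show ?thesis using z(1) w(2) by blast
qed

definition pinv :: "'v \<Rightarrow> 'v" where
  "pinv = (\<lambda>u\<in>T. THE z. z \<in> V \<and> H (u - H z) = 0)"

lemma pinv: "u \<in> T \<Longrightarrow> pinv u \<in> V" "u \<in> T \<Longrightarrow> H (u - H (pinv u)) = 0"
  using theI'[OF ex1_projection_preimage[of u]] by (simp_all add: pinv_def)

lemma pinv_eqI: "\<lbrakk>u \<in> T; z \<in> V; H (u - H z) = 0\<rbrakk> \<Longrightarrow> pinv u = z"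
  using ex1_projection_preimage[of u] pinv[of u] by blast

lemma ip_H_pinv:
  assumes "u \<in> T" "v \<in> V"
  shows "ip u v = ip (H (pinv u)) v"
  using assms pinv[of u] H_0_iff[of "u - H (pinv u)"] by (simp add: diff_left)

text \<open>Both \<open>H \<circ> pinv\<close> and \<open>pinv \<circ> H\<close> are the orthogonal projection onto \<open>V\<close>, which is where their
  self-adjointness comes from.\<close>

lemma penrose_pinv: "penrose H pinv"
proof -
  have HPH: "H (pinv (H u)) = H u" if u: "u \<in> T" for u
  proof -
    have "H (H (pinv (H u))) = H (H u)" using pinv[of "H u"] u by (simp add: H_diff)
    then show ?thesis using H_inj_on_V[of "H (pinv (H u))" "H u"] u pinv(1)[of "H u"] by simp
  qed
  have PHP: "pinv (H z) = z" if "z \<in> V" for z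
    using that H_scale[of 0 0] by (intro pinv_eqI) auto
  have "linear_operator_on T pinv"
    unfolding linear_operator_on_def
  proof (intro conjI ballI allI)
    show "pinv \<in> T \<rightarrow> T" using pinv(1) by auto
  next
    fix u v assume "u \<in> T" "v \<in> T"
    then show "pinv (u + v) = pinv u + pinv v"
      using pinv[of u] pinv[of v] by (intro pinv_eqI) (auto simp: V_closed H_add H_diff)
  next
    fix r u assume "u \<in> T"
    then show "pinv (r *\<^sub>R u) = r *\<^sub>R pinv u"
      using pinv[of u] by (intro pinv_eqI) (auto simp: V_closed H_scale H_diff)
  qed
  moreover have "self_adjoint_on (H \<circ> pinv)"
    unfolding self_adjoint_on_def
  proof (intro ballI)
    fix u v assume u: "u \<in> T" and v: "v \<in> T"
    have mem: "H (pinv u) \<in> V" "H (pinv v) \<in> V" using u v pinv(1) by auto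
    have "ip (H (pinv u)) v = ip v (H (pinv u))" using mem v by (simp add: sym)
    also have "\<dots> = ip (H (pinv v)) (H (pinv u))" by (rule ip_H_pinv[OF v mem(1)])
    also have "\<dots> = ip (H (pinv u)) (H (pinv v))" using mem by (simp add: sym)
    also have "\<dots> = ip u (H (pinv v))" by (rule ip_H_pinv[OF u mem(2), symmetric])
    finally show "ip ((H \<circ> pinv) u) v = ip u ((H \<circ> pinv) v)" by simp
  qed
  moreover have "self_adjoint_on (pinv \<circ> H)"
    unfolding self_adjoint_on_def
  proof (intro ballI)
    fix u v assume u: "u \<in> T" and v: "v \<in> T"
    \<comment> \<open>By \<open>HPH\<close>, the difference \<open>x - pinv (H x)\<close> lies in the kernel of \<open>H\<close>, so is orthogonal to \<open>V\<close>.\<close>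
    have proj: "ip x y = ip (pinv (H x)) y" if "x \<in> T" "y \<in> V" for x y
      using that HPH[of x] H_0_iff[of "x - pinv (H x)"] pinv(1)[of "H x"]
      by (simp add: H_diff diff_left)
    have mem: "pinv (H u) \<in> V" "pinv (H v) \<in> V" using u v pinv(1) by auto
    have "ip (pinv (H u)) v = ip v (pinv (H u))" using mem v by (simp add: sym)
    also have "\<dots> = ip (pinv (H v)) (pinv (H u))" by (rule proj[OF v mem(1)])
    also have "\<dots> = ip (pinv (H u)) (pinv (H v))" using mem by (simp add: sym)
    also have "\<dots> = ip u (pinv (H v))" by (rule proj[OF u mem(2), symmetric])
    finally show "ip ((pinv \<circ> H) u) v = ip u ((pinv \<circ> H) v)" by simp
  qed
  ultimately show ?thesis
    unfolding penrose_def using HPH PHP pinv(1) by (auto simp: pinv_def)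
qed

text \<open>A vector \<open>u\<close> of zero effort minimizes the effort, so its derivative vanishes there; moving
  from \<open>u\<close> against the derivative, that is along \<open>- H u\<close>, would otherwise make it negative.\<close>

lemma effort_0_imp_H_0:
  assumes u: "u \<in> T" and eff: "ip u (H u) = 0"
  shows "H u = 0"
proof (rule ccontr)
  assume "H u \<noteq> 0"
  define x where "x = H u"
  define a where "a = ip x x"
  define b where "b = ip x (H x)"
  have x: "x \<in> T" and a: "a > 0" and b: "b \<ge> 0"
    using u \<open>H u \<noteq> 0\<close> pos[of "H u"] H_psd[of "H u"] by (auto simp: x_def a_def b_def)
  have ux: "ip u (H x) = a" using u x H_swap[of u x] by (simp add: a_def x_def)
  have xu: "ip x (H u) = a" by (simp add: a_def x_def)
  define t where "t = a / (b + 1)"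
  have "ip (u - t *\<^sub>R x) (H (u - t *\<^sub>R x)) = t * t * b - 2 * t * a"
    using u x eff ux xu
    by (simp add: H_diff H_scale diff_left diff_right scale_left scale_right b_def[symmetric]
        algebra_simps)
  also have "\<dots> = t * (t * b - 2 * a)" by (simp add: algebra_simps)
  also have "\<dots> < 0"
  proof -
    have "t > 0" "t * b \<le> a" using a b by (auto simp: t_def field_simps)
    then show ?thesis using a by (intro mult_pos_neg) auto
  qed
  finally show False using H_psd[of "u - t *\<^sub>R x"] u x by simp
qed

lemma effort_pos: "\<lbrakk>u \<in> V; u \<noteq> 0\<rbrakk> \<Longrightarrow> 0 < ip u (H u)"
  using effort_0_imp_H_0[of u] H_psd[of u] H_inj_on_V[of u 0] H_scale[of 0 0]
    V_closed(2)[of u 0] by force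

lemma payoff_0:
  assumes "g \<in> T" "H g = 0" "u \<in> V"
  shows "ip g u = 0"
  using assms H_0_iff by blast

text \<open>Two vectors of effort 1 with effort product \<open>c\<close> differ by a vector of effort \<open>2 * (1 - c)\<close>, which
  is positive unless they are equal. This is Cauchy--Schwarz with its equality case in the form
  needed here: the payoff is \<open>s\<close> times the effort product with \<open>z\<close> normalized to effort 1, so that
  normalization is the unique maximizer, with payoff \<open>s\<close>.\<close>

lemma maximizer_iff:
  assumes g: "g \<in> T" and Hg: "H g \<noteq> 0"
  defines "z \<equiv> pinv g"
  defines "s \<equiv> sqrt (ip z (H z))"
  shows "is_arg_max (ip g) (\<lambda>u. u \<in> V \<and> ip u (H u) = 1) u \<longleftrightarrow> u = (1 / s) *\<^sub>R z"
    and "(\<exists>r>0. u = r *\<^sub>R z) \<and> ip u (H u) = 1 \<longleftrightarrow> u = (1 / s) *\<^sub>R z"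
proof -
  have z: "z \<in> V" using pinv(1) g by (simp add: z_def)
  have "z \<noteq> 0"
  proof
    assume "z = 0"
    then have "H (g - H 0) = 0" using pinv(2)[OF g] by (simp add: z_def)
    then show False using Hg H_scale[of 0 0] by simp
  qed
  then have eff_z: "ip z (H z) > 0" using effort_pos z by blast
  then have s: "s > 0" by (simp add: s_def)
  have ss: "s * s = ip z (H z)" using eff_z by (simp add: s_def)
  define m where "m = (1 / s) *\<^sub>R z"
  have m: "m \<in> V" using z V_closed by (simp add: m_def)
  have eff_scale: "ip (r *\<^sub>R z) (H (r *\<^sub>R z)) = r * r * (s * s)" for r
    using z by (simp add: H_scale scale_left scale_right ss)
  have eff_m: "ip m (H m) = 1" using eff_scale[of "1 / s"] s by (simp add: m_def)
  have payoff: "ip g u = s * ip m (H u)" if "u \<in> V" for u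
    using that z g s ip_H_pinv[of g u] H_swap[of z u] by (simp add: m_def scale_left z_def)
  have gap: "2 * (1 - ip m (H u)) = ip (m - u) (H (m - u))" if "u \<in> V" "ip u (H u) = 1" for u
    using that m eff_m H_swap[of u m] sym[of "H u" m]
    by (simp add: H_diff diff_left diff_right)
  have unit_lt: "ip m (H u) < 1" if "u \<in> V" "ip u (H u) = 1" "u \<noteq> m" for u
    using gap[OF that(1,2)] effort_pos[of "m - u"] that m V_closed(3)[OF m that(1)] by auto
  have lt: "ip g u < ip g m" if "u \<in> V" "ip u (H u) = 1" "u \<noteq> m" for u
    using unit_lt[OF that] payoff that(1) m eff_m s by simp
  show "is_arg_max (ip g) (\<lambda>u. u \<in> V \<and> ip u (H u) = 1) u \<longleftrightarrow> u = (1 / s) *\<^sub>R z"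
  proof -
    have "\<not> ip g m < ip g v" if "v \<in> V" "ip v (H v) = 1" for v
      using lt[OF that] by (cases "v = m") auto
    then show ?thesis
      unfolding is_arg_max_def m_def[symmetric] using lt m eff_m by blast
  qed
  show "(\<exists>r>0. u = r *\<^sub>R z) \<and> ip u (H u) = 1 \<longleftrightarrow> u = (1 / s) *\<^sub>R z"
  proof
    assume "(\<exists>r>0. u = r *\<^sub>R z) \<and> ip u (H u) = 1"
    then obtain r where r: "r > 0" "u = r *\<^sub>R z" "(r * s) * (r * s) = 1"
      using eff_scale by (auto simp: algebra_simps)
    moreover have "r * s > 0" using r(1) s by simp
    ultimately have "r * s = 1" using square_eq_1_iff[of "r * s"] by linarith
    then show "u = (1 / s) *\<^sub>R z" using r(2) s by (simp add: eq_divide_eq)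
  next
    assume "u = (1 / s) *\<^sub>R z"
    then show "(\<exists>r>0. u = r *\<^sub>R z) \<and> ip u (H u) = 1" using eff_m s
      by (auto simp: m_def intro!: exI[of _ "1 / s"])
  qed
qed

end

section \<open>Tangent spaces\<close>

context smooth_manifold
begin

lemma linear_transition_deriv:
  assumes "c \<in> charts_at A p" "d \<in> charts_at A p"
  shows "linear (transition_deriv c d p)"
proof -
  have "Ck_on (Suc 0) (snd c ` (fst c \<inter> fst d)) (snd d \<circ> chart_inv c)"
    using assms compatible[of c d] unfolding charts_at_def smooth_on_def by blast
  then have "(snd d \<circ> chart_inv c) differentiable (at (snd c p))"
    using assms by (simp add: charts_at_def)
  then show ?thesis unfolding transition_deriv_def by (rule linear_frechet_derivative)
qed

lemma tangent_spaceI: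
  assumes "\<And>c d. \<lbrakk>c \<in> charts_at A p; d \<in> charts_at A p\<rbrakk> \<Longrightarrow> v d = transition_deriv c d p (v c)"
    and "\<And>c. c \<notin> charts_at A p \<Longrightarrow> v c = 0"
  shows "v \<in> tangent_space A p"
  using assms unfolding tangent_space_def by blast

lemma tangent_space_transition:
  "\<lbrakk>v \<in> tangent_space A p; c \<in> charts_at A p; d \<in> charts_at A p\<rbrakk> \<Longrightarrow>
    v d = transition_deriv c d p (v c)"
  unfolding tangent_space_def by blast

lemma tangent_space_outside: "\<lbrakk>v \<in> tangent_space A p; c \<notin> charts_at A p\<rbrakk> \<Longrightarrow> v c = 0"
  unfolding tangent_space_def by blast

lemma subspace_tangent_space: "subspace (tangent_space A p)"
proof -
  note lin = linear_transition_deriv[where p = p]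
  show ?thesis
  proof (rule subspaceI)
    show "0 \<in> tangent_space A p"
      by (rule tangent_spaceI) (simp_all add: linear_0 lin)
  next
    fix u v assume uv: "u \<in> tangent_space A p" "v \<in> tangent_space A p"
    show "u + v \<in> tangent_space A p"
    proof (rule tangent_spaceI)
      fix c d assume cd: "c \<in> charts_at A p" "d \<in> charts_at A p"
      show "(u + v) d = transition_deriv c d p ((u + v) c)"
        using tangent_space_transition[OF uv(1) cd] tangent_space_transition[OF uv(2) cd]
        by (simp add: linear_add[OF lin[OF cd]])
    qed (simp add: tangent_space_outside[OF uv(1)] tangent_space_outside[OF uv(2)])
  next
    fix r v assume v: "v \<in> tangent_space A p"
    show "r *\<^sub>R v \<in> tangent_space A p"
    proof (rule tangent_spaceI)
      fix c d assume cd: "c \<in> charts_at A p" "d \<in> charts_at A p"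
      show "(r *\<^sub>R v) d = transition_deriv c d p ((r *\<^sub>R v) c)"
        using tangent_space_transition[OF v cd] by (simp add: scaleR_fun_def linear_scale[OF lin[OF cd]])
    qed (simp add: tangent_space_outside[OF v] scaleR_fun_def)
  qed
qed

text \<open>A tangent vector is determined by its representation in one chart. Hence the coordinate map
  of a chart is injective on a basis of the tangent space and keeps it independent, so the basis
  is finite.\<close>

lemma finite_dim_tangent_space:
  assumes "p \<in> points A"
  shows "\<exists>B. finite B \<and> tangent_space A p = span B"
proof -
  let ?T = "tangent_space A p"
  obtain c where c: "c \<in> charts_at A p" using assms by (auto simp: points_def charts_at_def)
  obtain E :: "'e set" where E: "finite E" "span E = UNIV" using finite_dim by blast
  define ev :: "('m, 'e) tvec \<Rightarrow> 'e" where "ev v = v c" for v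
  have lin: "linear ev" by unfold_locales (auto simp: ev_def scaleR_fun_def)
  have inj: "inj_on ev ?T"
  proof (rule inj_onI)
    fix u v assume uv: "u \<in> ?T" "v \<in> ?T" "ev u = ev v"
    show "u = v"
    proof
      fix d show "u d = v d"
      proof (cases "d \<in> charts_at A p")
        case True
        have "u d = transition_deriv c d p (u c)" "v d = transition_deriv c d p (v c)"
          using tangent_space_transition uv(1,2) c True by blast+
        then show ?thesis using uv(3) by (simp add: ev_def)
      next
        case False
        then show ?thesis using uv by (simp add: tangent_space_outside)
      qed
    qed
  qed
  obtain B where B: "B \<subseteq> ?T" "independent B" "?T \<subseteq> span B"
    using maximal_independent_subset by blast
  have span: "span B = ?T" using B subspace_tangent_space span_minimal by blast
  have "independent (ev ` B)"
    using linear_independent_injective_image[OF lin B(2)] inj span by simp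
  then have "finite (ev ` B)" using independent_span_bound[OF E(1)] E(2) by auto
  then have "finite B" using inj B(1) finite_imageD inj_on_subset by blast
  then show ?thesis using span by auto
qed

end

context riemannian_manifold
begin

lemma inner_product_on_tangent_space:
  assumes "p \<in> points A"
  shows "inner_product_on (tangent_space A p) (G p)"
proof (rule inner_product_on.intro)
  show "subspace (tangent_space A p)" by (rule subspace_tangent_space)
  fix u v w assume "u \<in> tangent_space A p" "v \<in> tangent_space A p" "w \<in> tangent_space A p"
  then show "G p (u + v) w = G p u w + G p v w" by (rule metric_add[OF assms])
next
  fix r u w assume "u \<in> tangent_space A p" "w \<in> tangent_space A p"
  then show "G p (r *\<^sub>R u) w = r * G p u w" by (rule metric_scale[OF assms])
next
  fix u v assume "u \<in> tangent_space A p" "v \<in> tangent_space A p"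
  then show "G p u v = G p v u" by (rule metric_sym[OF assms])
next
  fix u assume "u \<in> tangent_space A p" "u \<noteq> 0"
  then show "0 < G p u u" by (rule metric_pos[OF assms])
qed

lemma gradient_in_tangent_space:
  assumes p: "p \<in> points A" and J: "differentiable_at A J p"
  shows "gradient A G J p \<in> tangent_space A p"
proof -
  interpret inner_product_on "tangent_space A p" "G p"
    using inner_product_on_tangent_space[OF p] .
  define c where "c = (SOME c. c \<in> charts_at A p)"
  have "\<exists>c. c \<in> charts_at A p" using p by (auto simp: points_def charts_at_def)
  then have "c \<in> charts_at A p" unfolding c_def by (rule someI_ex)
  then have lin: "linear (frechet_derivative (J \<circ> chart_inv c) (at (snd c p)))"
    using J by (intro linear_frechet_derivative) (auto simp: differentiable_at_def)
  have dJ: "differential A J p v = frechet_derivative (J \<circ> chart_inv c) (at (snd c p)) (v c)" for v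
    by (simp add: differential_def c_def Let_def)
  obtain B where B: "finite B" "tangent_space A p = span B"
    using finite_dim_tangent_space[OF p] by blast
  have "\<exists>g\<in>span B. \<forall>v\<in>span B. G p g v = differential A J p v"
    using B span_superset[of B] lin
    by (intro Riesz_representation_span)
      (auto simp: dJ linear_add linear_scale scaleR_fun_def)
  then obtain g where g: "g \<in> tangent_space A p"
      "\<forall>v\<in>tangent_space A p. G p g v = differential A J p v"
    unfolding B(2)[symmetric] by blast
  then have "gradient A G J p = g"
    unfolding gradient_def by (intro the_equality) (auto intro: eq_if_ip_eq)
  then show ?thesis using g(1) by simp
qed

end

theorem theorem1:
  fixes A :: "('m::{t2_space, second_countable_topology}, 'e::real_normed_vector) chart set"
    and G :: "('m, 'e) metric" and \<theta> :: 'm and J :: "'m \<Rightarrow> real"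
    and V :: "('m, 'e) tvec set" and H :: "('m, 'e) tvec \<Rightarrow> ('m, 'e) tvec"
    and g :: "('m, 'e) tvec"
  assumes "riemannian_manifold A G" and "\<theta> \<in> points A"
    and "differentiable_at A J \<theta>" and "g = gradient A G J \<theta>"
    and "V \<subseteq> tangent_space A \<theta>" and "subspace V" and "closedin (tangent_topology A G \<theta>) V"
    and "linear_operator_on (tangent_space A \<theta>) H"
    and "self_adjoint A G \<theta> H" and "pos_semidef A G \<theta> H"
    and "H ` tangent_space A \<theta> = V"
    and "{u \<in> tangent_space A \<theta>. H u = 0} = orthogonal_compl A G \<theta> V"
  shows "(H g \<noteq> 0 \<longrightarrow>
      (\<exists>u. is_arg_max (G \<theta> g) (\<lambda>u. u \<in> admissible G \<theta> H V) u) \<and>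
      (\<forall>u. is_arg_max (G \<theta> g) (\<lambda>u. u \<in> admissible G \<theta> H V) u \<longleftrightarrow>
        (\<exists>r>0. u = r *\<^sub>R pseudoinverse A G \<theta> H g) \<and> effort G \<theta> H u = 1)) \<and>
    (H g = 0 \<longrightarrow>
      (\<forall>u\<in>admissible G \<theta> H V. G \<theta> g u = 0) \<and>
      \<not> (\<exists>u\<in>admissible G \<theta> H V. G \<theta> g u > 0))"
proof -
  interpret riemannian_manifold A G by fact
  interpret inner_product_on "tangent_space A \<theta>" "G \<theta>"
    using inner_product_on_tangent_space assms(2) .
  have self_adjoint: "self_adjoint A G \<theta> F \<longleftrightarrow> self_adjoint_on F" for F
    by (simp add: self_adjoint_def self_adjoint_on_def)
  interpret effort_operator "tangent_space A \<theta>" "G \<theta>" H V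
    using assms(5,6,8-12) finite_dim_tangent_space[OF assms(2)]
    by unfold_locales (auto simp: self_adjoint pos_semidef_def orthogonal_compl_def)
  have "pseudoinverse A G \<theta> H = (THE P. penrose H P)"
    by (simp add: pseudoinverse_def penrose_def self_adjoint)
  also have "\<dots> = pinv"
    using penrose_pinv penrose_unique[OF H_linear] by (intro the_equality) auto
  finally have pseudoinverse: "pseudoinverse A G \<theta> H = pinv" .
  have g: "g \<in> tangent_space A \<theta>" using gradient_in_tangent_space assms(2-4) by simp
  have adm: "u \<in> admissible G \<theta> H V \<longleftrightarrow> u \<in> V \<and> G \<theta> u (H u) = 1" for u
    by (simp add: admissible_def effort_def)
  show ?thesis
    unfolding adm pseudoinverse effort_def Ball_def Bex_def
    using maximizer_iff[OF g] payoff_0[OF g] by auto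
qed

end
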